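(* Let $n$ be a positive integer. Let $z_1,\dots,z_n$ be distinct complex numbers with $|z_i|=1$ and $z_i\neq 1$ for all $i$, such that $z_{n+1-i}=\overline{z_i}$ for all $i=1,\dots,n$. Suppose in addition that none of the ratios $z_i/z_j$ with $i\ne j$ is a root of unity. Then $$\inf_{k\in\mathbb{Z}}\sum_{j=1}^n z_j^k<-\frac{1}{\pi^4}\log n.$$
   Context: The sum $\sum_{j=1}^n z_j^k$ is real for every integer $k$ because of the conjugacy condition. The possibility that $z_i=-1$ for some $i$ is not excluded. $\log$ is the natural logarithm. *)

theory Defs
  imports "HOL-Analysis.Analysis"
begin

definition is_root_of_unity :: "complex \<Rightarrow> bool" where
  "is_root_of_unity w \<longleftrightarrow> (\<exists>m::nat. m > 0 \<and> w ^ m = 1)"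

definition power_sum :: "nat \<Rightarrow> (nat \<Rightarrow> complex) \<Rightarrow> int \<Rightarrow> complex" where
  "power_sum n z k = (\<Sum>j=1..n. z j powi k)"

(* The next two lemmas show that, in the intended setting, taking real parts of the
   power sums loses nothing and their real infimum is a genuine greatest lower bound
   (the conditionally complete Inf on the reals is unspecified for unbounded sets). *)

lemma power_sum_real:
  assumes "\<And>i. i \<in> {1..n} \<Longrightarrow> z (n + 1 - i) = cnj (z i)"
  shows "power_sum n z k \<in> \<real>"
proof -
  have "cnj (power_sum n z k) = (\<Sum>j=1..n. z (n + 1 - j) powi k)"
    unfolding power_sum_def cnj_sum using assms
    by (intro sum.cong) (auto simp: power_int_def)
  also have "\<dots> = power_sum n z k"
    unfolding power_sum_def
    by (rule sum.reindex_bij_witness[of _ "\<lambda>j. n + 1 - j" "\<lambda>j. n + 1 - j"]) auto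
  finally show ?thesis
    by (simp add: Reals_cnj_iff)
qed

lemma power_sum_bdd_below:
  assumes "\<And>i. i \<in> {1..n} \<Longrightarrow> norm (z i) = 1"
  shows "bdd_below (range (\<lambda>k. Re (power_sum n z k)))"
proof (rule bdd_belowI2)
  fix k
  have "norm (power_sum n z k) \<le> (\<Sum>j=1..n. norm (z j powi k))"
    unfolding power_sum_def by (rule norm_sum)
  also have "\<dots> = real n"
    using assms by (simp add: norm_power_int)
  finally show "- real n \<le> Re (power_sum n z k)"
    using abs_Re_le_cmod[of "power_sum n z k"] by linarith
qed

end

theory Submission
  imports Defs "HOL-Complex_Analysis.Cauchy_Integral_Formula"
begin

text \<open>
  Write \<open>f k\<close> for the power sum, a real number lying between \<open>- n\<close> and \<open>n\<close>. The infimum is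
  estimated in two ways, according to the size of \<open>n\<close>.

  \<^bold>\<open>Small \<open>n\<close>.\<close> The mean of \<open>w ^ k\<close> over \<open>k\<close> is \<open>0\<close> for every \<open>w \<noteq> 1\<close> on the unit circle. As the
  \<open>z\<^sub>j\<close> are distinct, different from \<open>1\<close> and closed under conjugation, \<open>f\<close> has mean \<open>0\<close> and \<open>f\<^sup>2\<close> has
  mean \<open>n\<close>. If \<open>f \<ge> - c\<close> throughout, then \<open>(f + c) (n - f) \<ge> 0\<close>, and taking means gives
  \<open>c n - n \<ge> 0\<close>. Hence \<open>f\<close> comes below \<open>- c\<close> for every \<open>c < 1\<close> (\<open>exists_power_sum_less\<close>), which is
  enough as long as \<open>ln n < pi ^ 4\<close>.

  \<^bold>\<open>Large \<open>n\<close>.\<close> The arguments of the \<open>z\<^sub>j\<close> have integer coordinates with respect to finitely many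
  reals that are independent of \<open>1\<close> over the integers. Kronecker's theorem together with a generic
  projection of these coordinates to a single integer yields integers \<open>a\<^sub>j\<close> such that every
  value of the trigonometric sum \<open>g t = (\<Sum>j. e (a\<^sub>j t))\<close>, with \<open>e x = exp (2 pi i x)\<close>, is a limit
  of values \<open>f k\<close> (\<open>powers_approximate_characters\<close>). The \<open>a\<^sub>j\<close> are distinct because no quotient
  \<open>z\<^sub>i / z\<^sub>j\<close> is a root of unity. So \<open>g\<close> is real, it has mean at most \<open>1\<close> (at most one \<open>a\<^sub>j\<close> vanishes),
  and by the theorem of McGehee, Pigno and Smith (Littlewood's conjecture) its \<open>L\<^sup>1\<close> norm is at least
  a constant times \<open>ln n\<close> (\<open>L1_norm_character_sum_ge\<close>). Since \<open>\<bar>g\<bar> \<le> g + 2 c\<close> whenever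
  \<open>- c \<le> g\<close>, the sum \<open>g\<close>, and with it \<open>f\<close>, takes values below a negative multiple of \<open>ln n\<close>.

  The \<open>L\<^sup>1\<close> bound is proved by duality: a function \<open>F\<close> with \<open>\<bar>F\<bar> \<le> 5\<close> is built whose
  correlation with \<open>g\<close> is at least \<open>J / 2\<close>, where \<open>J\<close> is of order \<open>ln n\<close>. The frequencies are cut,
  from the highest downwards, into blocks of sizes \<open>1, 4, 16, \<dots>\<close>. The normalised block sum \<open>f\<^sub>j\<close>
  has supremum at most \<open>1\<close> and \<open>L\<^sup>2\<close> norm \<open>2 ^ - j\<close>. There is an entire function \<open>h\<^sub>j\<close> with
  \<open>Re h\<^sub>j \<ge> \<bar>f\<^sub>j\<bar>\<close> on the unit circle and with comparable \<open>L\<^sup>2\<close> norm (\<open>analytic_majorant\<close>). In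
  \<open>F = (\<Sum>i. f\<^sub>i exp (- (\<Sum>l>i. h\<^sub>l) / 4))\<close> the exponential factors keep \<open>F\<close> bounded, they are
  \<open>L\<^sup>2\<close>-close to \<open>1\<close>, so that they disturb the coefficient of \<open>f\<^sub>i\<close> only a little, and, being
  analytic, they only raise frequencies, so that \<open>f\<^sub>i\<close> does not influence the coefficients belonging
  to the later blocks, whose frequencies are lower.
\<close>

section \<open>Means over the unit circle\<close>

definition circ :: "real \<Rightarrow> complex" where
  "circ t = cis (2 * pi * t)"

definition character :: "int \<Rightarrow> real \<Rightarrow> complex" where
  "character a t = cis (2 * pi * (of_int a * t))"

lemma norm_circ [simp]: "norm (circ t) = 1"
  by (simp add: circ_def)

lemma norm_character [simp]: "norm (character a t) = 1"
  by (simp add: character_def)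

lemma character_0 [simp]: "character 0 t = 1"
  by (simp add: character_def)

lemma character_mult: "character a t * character b t = character (a + b) t"
  by (simp add: character_def cis_mult algebra_simps)

lemma cnj_character: "cnj (character a t) = character (- a) t"
  by (simp add: character_def cis_cnj)

lemma character_nat: "character (int d) t = circ t ^ d"
  by (simp add: character_def circ_def Complex.DeMoivre mult_ac)

lemma continuous_on_circ [continuous_intros]: "continuous_on S circ"
  unfolding circ_def by (intro continuous_intros)

lemma continuous_on_character [continuous_intros]: "continuous_on S (character a)"
  unfolding character_def by (intro continuous_intros)

lemma continuous_on_entire_circ:
  assumes "h holomorphic_on UNIV"
  shows "continuous_on S (\<lambda>t. h (circ t))"
  using continuous_on_compose2[OF holomorphic_on_imp_continuous_on[OF assms] continuous_on_circ]
  by simp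

lemma integrable_01:
  fixes f :: "real \<Rightarrow> 'a::euclidean_space"
  assumes "continuous_on UNIV f"
  shows "f integrable_on {0..1}"
  by (rule integrable_continuous_real) (rule continuous_on_subset[OF assms], simp)

text \<open>
  The mean value property: Cauchy's formula for the unit circle at the centre, read in the
  parameter \<open>t\<close>.
\<close>

lemma integral_circ_entire:
  assumes "G holomorphic_on UNIV"
  shows "integral {0..1} (\<lambda>t. G (circ t)) = G 0"
proof -
  have "((\<lambda>u. G u / (u - 0)) has_contour_integral (2 * of_real pi * \<i> * G 0)) (circlepath 0 1)"
    by (rule Cauchy_integral_circlepath_simple) (auto intro: holomorphic_on_subset[OF assms])
  then have "((\<lambda>t. G (circlepath 0 1 t) / circlepath 0 1 t * vector_derivative (circlepath 0 1) (at t within {0..1}))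
       has_integral (2 * of_real pi * \<i> * G 0)) {0..1}"
    by (simp add: has_contour_integral_def)
  moreover have "G (circlepath 0 1 t) / circlepath 0 1 t * vector_derivative (circlepath 0 1) (at t within {0..1})
      = (2 * of_real pi * \<i>) * G (circ t)" if "t \<in> {0..1}" for t
  proof -
    have "circlepath 0 1 t = circ t"
      by (simp add: circlepath circ_def cis_conv_exp mult_ac)
    moreover have "vector_derivative (circlepath 0 1) (at t within {0..1}) = 2 * of_real pi * \<i> * circ t"
      using that by (simp add: vector_derivative_circlepath01 circ_def cis_conv_exp mult_ac)
    moreover have "circ t \<noteq> 0"
      by (metis norm_circ norm_zero zero_neq_one)
    ultimately show ?thesis by simp
  qed
  ultimately have "((\<lambda>t. (2 * of_real pi * \<i>) * G (circ t)) has_integral (2 * of_real pi * \<i>) * G 0) {0..1}"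
    using has_integral_cong[of "{0..1}"] by (metis (no_types, lifting))
  then have "((\<lambda>t. inverse (2 * of_real pi * \<i>) * ((2 * of_real pi * \<i>) * G (circ t))) has_integral
      inverse (2 * of_real pi * \<i>) * ((2 * of_real pi * \<i>) * G 0)) {0..1}"
    by (rule has_integral_mult_right)
  then have "((\<lambda>t. G (circ t)) has_integral G 0) {0..1}"
    by (simp add: field_simps)
  then show ?thesis by (rule integral_unique)
qed

text \<open>
  An entire function has no negative frequencies on the circle. This is what makes the
  coefficients of a product of block sum and analytic factor vanish below the block.
\<close>

lemma integral_character_entire:
  assumes "G holomorphic_on UNIV" "a > 0"
  shows "integral {0..1} (\<lambda>t. character a t * G (circ t)) = 0"
proof -
  have "integral {0..1} (\<lambda>t. (\<lambda>u. u ^ nat a * G u) (circ t)) = 0 ^ nat a * G 0"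
    by (rule integral_circ_entire) (intro holomorphic_intros assms)
  moreover have "character a t = circ t ^ nat a" for t
    using character_nat[of "nat a" t] assms by simp
  ultimately show ?thesis using assms by simp
qed

lemma integral_character: "integral {0..1} (character a) = (if a = 0 then 1 else 0)"
proof -
  have pos: "integral {0..1} (character b) = 0" if "b > 0" for b
    using integral_character_entire[of "\<lambda>_. 1" b] that by simp
  consider "a = 0" | "a > 0" | "a < 0" by linarith
  then show ?thesis
  proof cases
    case 1
    have "character 0 = (\<lambda>t. 1)" by (rule ext) simp
    then show ?thesis using 1 by simp
  next
    case 2 then show ?thesis using pos by simp
  next
    case 3
    have "integral {0..1} (\<lambda>t. cnj (character (- a) t)) = cnj (integral {0..1} (character (- a)))"
      by (rule integral_cnj[symmetric])
    then have "integral {0..1} (character a) = cnj (integral {0..1} (character (- a)))"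
      by (simp add: cnj_character)
    then show ?thesis using 3 pos[of "- a"] by simp
  qed
qed

section \<open>Trigonometric polynomials and their analytic majorants\<close>

inductive trig_poly :: "(real \<Rightarrow> complex) \<Rightarrow> bool" where
  monomial: "trig_poly (\<lambda>t. c * character a t)"
| add: "trig_poly f \<Longrightarrow> trig_poly g \<Longrightarrow> trig_poly (\<lambda>t. f t + g t)"

lemma trig_poly_const: "trig_poly (\<lambda>t. c)"
  using monomial[of c 0] by simp

lemma trig_poly_sum: "(\<And>i. i \<in> A \<Longrightarrow> trig_poly (f i)) \<Longrightarrow> trig_poly (\<lambda>t. \<Sum>i\<in>A. f i t)"
  by (induction A rule: infinite_finite_induct) (auto intro: trig_poly_const add)

lemma trig_poly_cnj: "trig_poly f \<Longrightarrow> trig_poly (\<lambda>t. cnj (f t))"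
proof (induction rule: trig_poly.induct)
  case (monomial c a)
  then show ?case using trig_poly.monomial[of "cnj c" "- a"] by (simp add: cnj_character)
qed (auto intro: add)

lemma trig_poly_mult:
  assumes "trig_poly f" "trig_poly g"
  shows "trig_poly (\<lambda>t. f t * g t)"
  using assms(1)
proof (induction rule: trig_poly.induct)
  case (monomial c a)
  show ?case using assms(2)
  proof (induction rule: trig_poly.induct)
    case (monomial d b)
    have "(\<lambda>t. c * character a t * (d * character b t)) = (\<lambda>t. (c * d) * character (a + b) t)"
      by (simp add: character_mult[symmetric] mult_ac)
    then show ?case by (metis trig_poly.monomial)
  qed (auto simp: distrib_left intro: add)
qed (auto simp: distrib_right intro: add)

lemma trig_poly_power: "trig_poly f \<Longrightarrow> trig_poly (\<lambda>t. f t ^ m)"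
  by (induction m) (auto intro: trig_poly_const trig_poly_mult)

lemma continuous_on_trig_poly: "trig_poly f \<Longrightarrow> continuous_on S f"
  by (induction rule: trig_poly.induct) (auto intro!: continuous_intros)

text \<open>
  A monomial of negative frequency has the same real part as its conjugate, which is a monomial
  of positive frequency.
\<close>

lemma trig_poly_analytic_completion:
  assumes "trig_poly g"
  shows "\<exists>h. h holomorphic_on UNIV \<and> Im (h 0) = 0 \<and> (\<forall>t. Re (h (circ t)) = Re (g t))"
  using assms
proof (induction rule: trig_poly.induct)
  case (monomial c a)
  consider "a > 0" | "a = 0" | "a < 0" by linarith
  then show ?case
  proof cases
    case 1
    then have "(\<lambda>u. c * u ^ nat a) holomorphic_on UNIV" "Im (c * 0 ^ nat a) = 0"
      "\<forall>t. Re (c * circ t ^ nat a) = Re (c * character a t)"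
      by (intro holomorphic_intros) (use 1 in \<open>simp_all flip: character_nat\<close>)
    then show ?thesis by blast
  next
    case 2
    then show ?thesis by (intro exI[of _ "\<lambda>u. of_real (Re c)"]) auto
  next
    case 3
    have "cnj (c * character a t) = cnj c * circ t ^ nat (- a)" for t
      using character_nat[of "nat (- a)" t] 3 by (simp add: cnj_character)
    then have "Re (cnj c * circ t ^ nat (- a)) = Re (c * character a t)" for t
      by (metis cnj.sel(1))
    moreover have "(\<lambda>u. cnj c * u ^ nat (- a)) holomorphic_on UNIV"
      by (intro holomorphic_intros)
    moreover have "Im (cnj c * 0 ^ nat (- a)) = 0"
      using 3 by simp
    ultimately show ?thesis by blast
  qed
next
  case (add f g)
  then obtain h k where h: "h holomorphic_on UNIV" "Im (h 0) = 0" "\<forall>t. Re (h (circ t)) = Re (f t)"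
    and k: "k holomorphic_on UNIV" "Im (k 0) = 0" "\<forall>t. Re (k (circ t)) = Re (g t)" by blast
  have "(\<lambda>u. h u + k u) holomorphic_on UNIV"
    by (intro holomorphic_intros h k)
  then show ?case
    using h k by (intro exI[of _ "\<lambda>u. h u + k u"]) simp
qed

text \<open>
  The mean of \<open>h\<^sup>2\<close> is \<open>(h 0)\<^sup>2\<close>, a nonnegative real. Hence the mean of \<open>(Im h)\<^sup>2\<close> does not exceed that
  of \<open>(Re h)\<^sup>2\<close>: the conjugate function is bounded in \<open>L\<^sup>2\<close>.
\<close>

lemma integral_norm_square_le_Re:
  assumes h: "h holomorphic_on UNIV" and "Im (h 0) = 0"
  shows "integral {0..1} (\<lambda>t. (norm (h (circ t)))\<^sup>2) \<le> 2 * integral {0..1} (\<lambda>t. (Re (h (circ t)))\<^sup>2)"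
proof -
  note [continuous_intros] = continuous_on_entire_circ[OF h]
  have "integral {0..1} (\<lambda>t. Re ((h (circ t))\<^sup>2)) = Re (integral {0..1} (\<lambda>t. (h (circ t))\<^sup>2))"
    using integral_linear[OF integrable_01 bounded_linear_Re, of "\<lambda>t. (h (circ t))\<^sup>2"]
    by (simp add: o_def continuous_intros)
  also have "integral {0..1} (\<lambda>t. (h (circ t))\<^sup>2) = (h 0)\<^sup>2"
    by (rule integral_circ_entire) (intro holomorphic_intros h)
  finally have "integral {0..1} (\<lambda>t. Re ((h (circ t))\<^sup>2)) \<ge> 0"
    using assms(2) by (simp add: power2_eq_square)
  moreover have "integral {0..1} (\<lambda>t. (norm (h (circ t)))\<^sup>2) + integral {0..1} (\<lambda>t. Re ((h (circ t))\<^sup>2))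
     = integral {0..1} (\<lambda>t. (norm (h (circ t)))\<^sup>2 + Re ((h (circ t))\<^sup>2))"
    by (rule integral_add[symmetric]) (intro integrable_01 continuous_intros)+
  moreover have "\<dots> = 2 * integral {0..1} (\<lambda>t. (Re (h (circ t)))\<^sup>2)"
  proof -
    have "(norm u)\<^sup>2 + Re (u\<^sup>2) = 2 * (Re u)\<^sup>2" for u
      by (simp add: cmod_power2) (simp add: power2_eq_square)
    then show ?thesis by simp
  qed
  ultimately show ?thesis by linarith
qed

text \<open>
  Since \<open>\<bar>f\<bar> = sqrt (f * cnj f)\<close> with \<open>f * cnj f\<close> in the unit interval, a polynomial approximation of
  the square root turns \<open>\<bar>f\<bar>\<close> into a trigonometric polynomial.
\<close>

lemma trig_poly_approx_norm:
  assumes f: "trig_poly f" and le1: "\<And>t. norm (f t) \<le> 1" and \<delta>: "\<delta> > 0"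
  shows "\<exists>g. trig_poly g \<and> (\<forall>t. norm (f t) \<le> Re (g t) \<and> Re (g t) \<le> norm (f t) + \<delta>)"
proof -
  have "continuous_on {0..1} (\<lambda>x. sqrt x)" by (intro continuous_intros)
  from Bernstein_Weierstrass[OF this, of "\<delta>/2"] \<delta> obtain N where
    N: "\<And>x. x \<in> {0..1} \<Longrightarrow> \<bar>sqrt x - (\<Sum>k\<le>N. sqrt (k/N) * Bernstein N k x)\<bar> < \<delta>/2"
    by auto
  define s where "s = (\<lambda>t. f t * cnj (f t))"
  \<comment> \<open>The shift by \<open>\<delta> / 2\<close> turns a two-sided approximation with error \<open>\<delta> / 2\<close> into an upper bound.\<close>
  define g where "g = (\<lambda>t. of_real (\<delta>/2) + (\<Sum>k\<le>N. (of_real (sqrt (k/N)) * of_nat (N choose k)) * (s t ^ k * (1 + (-1) * s t) ^ (N - k))))"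
  have s: "s t = of_real ((norm (f t))\<^sup>2)" for t
    by (simp only: s_def complex_norm_square)
  have s': "trig_poly s" unfolding s_def by (rule trig_poly_mult[OF f trig_poly_cnj[OF f]])
  have "trig_poly (\<lambda>t. c * (s t ^ k * (1 + (-1) * s t) ^ m))" for c k m
    by (rule trig_poly_mult[OF trig_poly_const trig_poly_mult[OF trig_poly_power[OF s'] trig_poly_power
          [OF trig_poly.add[OF trig_poly_const trig_poly_mult[OF trig_poly_const s']]]]])
  then have "trig_poly g" unfolding g_def
    by (rule trig_poly.add[OF trig_poly_const trig_poly_sum])
  have g: "Re (g t) = \<delta>/2 + (\<Sum>k\<le>N. sqrt (k/N) * Bernstein N k ((norm (f t))\<^sup>2))" for t
  proof -
    have "g t = of_real (\<delta>/2 + (\<Sum>k\<le>N. sqrt (k/N) * Bernstein N k ((norm (f t))\<^sup>2)))"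
      unfolding g_def s Bernstein_def
      by (simp only: of_real_add of_real_sum of_real_mult of_real_power of_real_diff of_real_1
          of_real_of_nat_eq mult_minus_left mult_1_left mult.assoc flip: diff_conv_add_uminus)
    then show ?thesis by (simp only: Re_complex_of_real)
  qed
  have close: "\<bar>norm (f t) - (\<Sum>k\<le>N. sqrt (k/N) * Bernstein N k ((norm (f t))\<^sup>2))\<bar> < \<delta>/2" for t
    using N[of "(norm (f t))\<^sup>2"] le1[of t] by (simp add: power_le_one)
  show ?thesis
  proof (intro exI[of _ g] conjI allI)
    fix t
    show "norm (f t) \<le> Re (g t)" "Re (g t) \<le> norm (f t) + \<delta>"
      using close[of t] unfolding g abs_less_iff by linarith+
  qed fact
qed

text \<open>
  The function \<open>h\<close> replaces \<open>\<bar>f\<bar>\<close> plus \<open>\<i>\<close> times its conjugate function. Using a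
  trigonometric polynomial slightly above \<open>\<bar>f\<bar>\<close> instead of \<open>\<bar>f\<bar>\<close> itself makes \<open>h\<close> entire, at the price of
  the small error \<open>\<eta>\<close>.
\<close>

lemma analytic_majorant:
  assumes f: "trig_poly f" and le1: "\<And>t. norm (f t) \<le> 1" and \<eta>: "\<eta> > 0"
  obtains h where "h holomorphic_on UNIV" "\<And>t. norm (f t) \<le> Re (h (circ t))"
    "integral {0..1} (\<lambda>t. (norm (h (circ t)))\<^sup>2) \<le> 2 * integral {0..1} (\<lambda>t. (norm (f t))\<^sup>2) + \<eta>"
proof -
  \<comment> \<open>For \<open>\<delta> \<le> 1\<close> the square of \<open>\<bar>f\<bar> + \<delta>\<close> exceeds that of \<open>\<bar>f\<bar>\<close> by at most \<open>3 \<delta>\<close>, and the \<open>L\<^sup>2\<close> bound for \<open>h\<close> doubles this.\<close>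
  define \<delta> where "\<delta> = min 1 (\<eta>/6)"
  have \<delta>: "\<delta> > 0" "\<delta> \<le> 1" "6 * \<delta> \<le> \<eta>" using \<eta> by (simp_all add: \<delta>_def min_def)
  obtain g where g: "trig_poly g" "\<And>t. norm (f t) \<le> Re (g t)" "\<And>t. Re (g t) \<le> norm (f t) + \<delta>"
    using trig_poly_approx_norm[OF f le1 \<delta>(1)] by blast
  obtain h where h: "h holomorphic_on UNIV" "Im (h 0) = 0" "\<And>t. Re (h (circ t)) = Re (g t)"
    using trig_poly_analytic_completion[OF g(1)] by blast
  note [continuous_intros] = continuous_on_entire_circ[OF h(1)] continuous_on_trig_poly[OF f]
  have "integral {0..1} (\<lambda>t. (Re (h (circ t)))\<^sup>2) \<le> integral {0..1} (\<lambda>t. (norm (f t))\<^sup>2 + 3 * \<delta>)"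
  proof (rule integral_le)
    fix t
    have "(Re (h (circ t)))\<^sup>2 \<le> (norm (f t) + \<delta>)\<^sup>2"
      unfolding h(3) using order_trans[OF norm_ge_zero g(2)[of t]] by (intro power_mono g(3))
    also have "\<dots> = (norm (f t))\<^sup>2 + 2 * \<delta> * norm (f t) + \<delta> * \<delta>"
      by (simp add: power2_eq_square algebra_simps)
    also have "\<dots> \<le> (norm (f t))\<^sup>2 + 2 * \<delta> * 1 + \<delta> * 1"
      using \<delta> le1[of t] by (intro add_mono mult_left_mono) auto
    finally show "(Re (h (circ t)))\<^sup>2 \<le> (norm (f t))\<^sup>2 + 3 * \<delta>" by simp
  qed (intro integrable_01 continuous_intros)+
  also have "\<dots> = integral {0..1} (\<lambda>t. (norm (f t))\<^sup>2) + 3 * \<delta>"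
    by (subst integral_add) (intro integrable_01 continuous_intros | simp)+
  finally have bound: "integral {0..1} (\<lambda>t. (norm (h (circ t)))\<^sup>2) \<le> 2 * integral {0..1} (\<lambda>t. (norm (f t))\<^sup>2) + \<eta>"
    using integral_norm_square_le_Re[OF h(1,2)] \<delta>(3) by linarith
  show ?thesis
    by (rule that[OF h(1) _ bound]) (simp add: h(3) g(2))
qed

section \<open>The norm of an exponential sum\<close>

lemma norm_exp_minus_one_le:
  fixes w :: complex
  assumes "Re w \<le> 0"
  shows "norm (exp w - 1) \<le> norm w"
proof -
  have "norm (exp w - exp 0) \<le> 1 * norm (w - 0)"
  proof (rule field_differentiable_bound[of "{z. Re z \<le> 0}" exp exp])
    show "convex {z. Re z \<le> 0}" by (rule convex_halfspace_Re_le)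
    show "(exp has_field_derivative exp z) (at z within {z. Re z \<le> 0})" for z
      by (rule DERIV_exp[THEN has_field_derivative_at_within])
  qed (use assms in auto)
  then show ?thesis by simp
qed

text \<open>
  The left-hand side is convex in \<open>x\<close> and equals \<open>5\<close> at \<open>0\<close>, so only \<open>x = 1\<close> matters, where the claim
  says \<open>exp (- 1 / 4) \<le> 4 / 5\<close>. The bound \<open>5\<close> for the test function
  is chosen for this reason. The proof goes through \<open>exp (- y) \<le> 1 / (1 + y)\<close>.
\<close>

lemma five_exp_add_le_five:
  fixes x :: real
  assumes "0 \<le> x" "x \<le> 1"
  shows "5 * exp (- x / 4) + x \<le> 5"
proof -
  have "exp (- x / 4) \<le> 1 / (1 + x / 4)"
    using exp_ge_add_one_self[of "x/4"] assms by (simp add: exp_minus field_simps)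
  moreover have "5 * (1 / (1 + x / 4)) + x \<le> 5"
  proof -
    have "x * x \<le> x * 1" using assms by (intro mult_left_mono) auto
    then show ?thesis using assms by (simp add: field_simps)
  qed
  ultimately show ?thesis by linarith
qed

text \<open>
  Passing from \<open>J\<close> to \<open>J + 1\<close> multiplies the sum by \<open>exp (- h\<^sub>J / 4)\<close> and adds \<open>f\<^sub>J\<close>. The
  factor shrinks the sum by at least \<open>exp (- \<bar>f\<^sub>J\<bar> / 4)\<close>, which makes room for the new term.
\<close>

lemma norm_damped_sum_le:
  fixes f h :: "nat \<Rightarrow> complex"
  assumes "\<And>i. i < J \<Longrightarrow> norm (f i) \<le> 1" and "\<And>i. i < J \<Longrightarrow> norm (f i) \<le> Re (h i)"
  shows "norm (\<Sum>i<J. f i * exp (- (\<Sum>l\<in>{i<..<J}. h l) / 4)) \<le> 5"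
  using assms
proof (induction J)
  case (Suc J)
  let ?F = "\<lambda>J. \<Sum>i<J. f i * exp (- (\<Sum>l\<in>{i<..<J}. h l) / 4)"
  have eq: "f i * exp (- (\<Sum>l\<in>{i<..<Suc J}. h l) / 4)
      = f i * exp (- (\<Sum>l\<in>{i<..<J}. h l) / 4) * exp (- h J / 4)" if "i < J" for i
  proof -
    have "{i<..<Suc J} = insert J {i<..<J}" using that by auto
    then have "- (\<Sum>l\<in>{i<..<Suc J}. h l) / 4 = - (\<Sum>l\<in>{i<..<J}. h l) / 4 + - h J / 4"
      by (simp add: field_simps)
    then show ?thesis by (simp only: exp_add mult.assoc)
  qed
  have "(\<Sum>i<J. f i * exp (- (\<Sum>l\<in>{i<..<Suc J}. h l) / 4)) = ?F J * exp (- h J / 4)"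
    unfolding sum_distrib_right by (rule sum.cong[OF refl], rule eq, simp)
  moreover have "{J<..<Suc J} = {}" by auto
  ultimately have F_Suc: "?F (Suc J) = ?F J * exp (- h J / 4) + f J" by simp
  have "norm (?F (Suc J)) \<le> norm (?F J * exp (- h J / 4)) + norm (f J)"
    unfolding F_Suc by (rule norm_triangle_ineq)
  also have "norm (?F J * exp (- h J / 4)) = norm (?F J) * exp (- Re (h J) / 4)"
    by (simp add: norm_mult)
  also have "\<dots> \<le> 5 * exp (- norm (f J) / 4)"
    using Suc.IH Suc.prems[of J] by (intro mult_mono) (use Suc.prems in simp_all)
  also have "5 * exp (- norm (f J) / 4) + norm (f J) \<le> 5"
    using Suc.prems(1)[of J] by (intro five_exp_add_le_five) auto
  finally show ?case by simp
qed simp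

text \<open>
  The Cauchy--Schwarz inequality, obtained by integrating the inequality between arithmetic and
  geometric mean with the weights \<open>B / A\<close> and \<open>A / B\<close>.
\<close>

lemma integral_mult_le_of_squares:
  fixes u v :: "real \<Rightarrow> real"
  assumes [continuous_intros]: "continuous_on UNIV u" "continuous_on UNIV v"
    and "integral {0..1} (\<lambda>t. (u t)\<^sup>2) \<le> A\<^sup>2" "integral {0..1} (\<lambda>t. (v t)\<^sup>2) \<le> B\<^sup>2" "A > 0" "B > 0"
  shows "integral {0..1} (\<lambda>t. u t * v t) \<le> A * B"
proof -
  have "integral {0..1} (\<lambda>t. u t * v t) \<le> integral {0..1} (\<lambda>t. B / (2 * A) * (u t)\<^sup>2 + A / (2 * B) * (v t)\<^sup>2)"
  proof (rule integral_le)
    fix t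
    have "0 \<le> (B * u t - A * v t)\<^sup>2 / (2 * A * B)" using assms by simp
    then show "u t * v t \<le> B / (2 * A) * (u t)\<^sup>2 + A / (2 * B) * (v t)\<^sup>2"
      using assms by (simp add: power2_eq_square field_simps)
  qed (intro integrable_01 continuous_intros)+
  also have "\<dots> = B / (2 * A) * integral {0..1} (\<lambda>t. (u t)\<^sup>2) + A / (2 * B) * integral {0..1} (\<lambda>t. (v t)\<^sup>2)"
    by (subst integral_add) (intro integrable_01 continuous_intros | simp)+
  also have "\<dots> \<le> B / (2 * A) * A\<^sup>2 + A / (2 * B) * B\<^sup>2"
    using assms by (intro add_mono mult_left_mono) auto
  also have "\<dots> = A * B" using assms by (simp add: power2_eq_square)
  finally show ?thesis .
qed

text \<open>
  On the half plane \<open>Re w \<le> 0\<close> the distance from \<open>exp w\<close> to \<open>1\<close> is at most \<open>\<bar>w\<bar>\<close>, so replacing the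
  exponential factor by \<open>1\<close> costs at most the scalar products of \<open>\<bar>f\<bar>\<close> with the \<open>\<bar>h\<^sub>l\<bar>\<close>.
\<close>

lemma integral_exp_perturbation_le:
  fixes f :: "real \<Rightarrow> complex" and h :: "nat \<Rightarrow> real \<Rightarrow> complex"
  assumes fc [continuous_intros]: "continuous_on UNIV f"
    and hc: "\<And>l. l \<in> L \<Longrightarrow> continuous_on UNIV (h l)" and L: "finite L"
    and Re: "\<And>l t. l \<in> L \<Longrightarrow> 0 \<le> Re (h l t)"
    and A: "integral {0..1} (\<lambda>t. (norm (f t))\<^sup>2) \<le> A\<^sup>2" "A > 0"
    and B: "\<And>l. l \<in> L \<Longrightarrow> integral {0..1} (\<lambda>t. (norm (h l t))\<^sup>2) \<le> (B l)\<^sup>2" "\<And>l. l \<in> L \<Longrightarrow> B l > 0"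
  shows "integral {0..1} (\<lambda>t. norm (f t) * norm (exp (- (\<Sum>l\<in>L. h l t) / 4) - 1)) \<le> A / 4 * (\<Sum>l\<in>L. B l)"
proof -
  have [continuous_intros]: "continuous_on UNIV (\<lambda>t. \<Sum>l\<in>L. g (h l t))"
    if "continuous_on UNIV g" for g :: "complex \<Rightarrow> 'b::real_normed_vector"
    using hc continuous_on_compose2[OF that] by (intro continuous_intros) auto
  have [continuous_intros]: "continuous_on UNIV (\<lambda>t. \<Sum>l\<in>L. h l t)"
    using hc by (intro continuous_intros)
  have "integral {0..1} (\<lambda>t. norm (f t) * norm (exp (- (\<Sum>l\<in>L. h l t) / 4) - 1))
      \<le> integral {0..1} (\<lambda>t. \<Sum>l\<in>L. 1/4 * (norm (f t) * norm (h l t)))"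
  proof (rule integral_le)
    fix t
    have "norm (exp (- (\<Sum>l\<in>L. h l t) / 4) - 1) \<le> norm (- (\<Sum>l\<in>L. h l t) / 4)"
      using Re by (intro norm_exp_minus_one_le) (auto intro!: sum_nonneg)
    also have "\<dots> \<le> 1/4 * (\<Sum>l\<in>L. norm (h l t))"
      by (simp add: norm_divide norm_sum)
    finally have "norm (f t) * norm (exp (- (\<Sum>l\<in>L. h l t) / 4) - 1) \<le> norm (f t) * (1/4 * (\<Sum>l\<in>L. norm (h l t)))"
      by (rule mult_left_mono) simp
    then show "norm (f t) * norm (exp (- (\<Sum>l\<in>L. h l t) / 4) - 1) \<le> (\<Sum>l\<in>L. 1/4 * (norm (f t) * norm (h l t)))"
      by (simp add: sum_distrib_left mult_ac)
  qed (use hc in \<open>intro integrable_01 continuous_intros; simp\<close>)+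
  also have "\<dots> = (\<Sum>l\<in>L. 1/4 * integral {0..1} (\<lambda>t. norm (f t) * norm (h l t)))"
    using hc by (subst integral_sum[OF L]) (intro integrable_01 continuous_intros | simp)+
  also have "\<dots> \<le> (\<Sum>l\<in>L. 1/4 * (A * B l))"
    using hc A B by (intro sum_mono mult_left_mono integral_mult_le_of_squares continuous_intros) auto
  also have "\<dots> = A / 4 * (\<Sum>l\<in>L. B l)" by (simp add: sum_distrib_left)
  finally show ?thesis .
qed

text \<open>
  Parseval's identity for coefficients \<open>1\<close>.
\<close>

lemma integral_norm_square_character_sum:
  assumes "finite M" "inj_on a M"
  shows "integral {0..1} (\<lambda>t. (norm (\<Sum>m\<in>M. character (a m) t))\<^sup>2) = card M"
proof -
  have bl: "bounded_linear complex_of_real" by (rule bounded_linear_of_real)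
  have "of_real (integral {0..1} (\<lambda>t. (norm (\<Sum>m\<in>M. character (a m) t))\<^sup>2))
      = integral {0..1} (\<lambda>t. complex_of_real ((norm (\<Sum>m\<in>M. character (a m) t))\<^sup>2))"
    by (rule integral_linear[OF integrable_01 bl, unfolded o_def, symmetric]) (intro continuous_intros)
  also have "\<dots> = integral {0..1} (\<lambda>t. \<Sum>m\<in>M. \<Sum>k\<in>M. character (a m - a k) t)"
    unfolding complex_norm_square
    by (simp add: cnj_character character_mult sum_product)
  also have "\<dots> = (\<Sum>m\<in>M. \<Sum>k\<in>M. integral {0..1} (character (a m - a k)))"
    by (subst integral_sum, fact assms, intro integrable_01 continuous_intros)+ (rule refl)
  also have "\<dots> = (\<Sum>m\<in>M. \<Sum>k\<in>M. if m = k then 1 else 0)"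
    using assms(2) by (intro sum.cong refl) (simp add: integral_character inj_on_eq_iff)
  also have "\<dots> = of_real (card M)" using assms(1) by simp
  finally show ?thesis by (simp only: of_real_eq_iff)
qed

text \<open>
  With \<open>4 ^ j\<close> indices in the block \<open>j\<close>, the mean of the characters over the block has \<open>L\<^sup>2\<close> norm
  \<open>2 ^ - j\<close>: these norms are summable, while the blocks up to \<open>n\<close> are as many as a multiple of
  \<open>ln n\<close>.
\<close>

definition block :: "nat \<Rightarrow> nat set" where
  "block j = {(\<Sum>i<j. 4 ^ i)..<(\<Sum>i<Suc j. 4 ^ i)}"

lemma finite_block [simp]: "finite (block j)" and card_block: "card (block j) = 4 ^ j"
  by (simp_all add: block_def)

lemma block_less:
  assumes "i < j" "k \<in> block i" "m \<in> block j"
  shows "k < m"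
proof -
  have "(\<Sum>l<Suc i. 4 ^ l) \<le> (\<Sum>l<j. 4 ^ l :: nat)"
    using assms(1) by (intro sum_mono2) auto
  then show ?thesis using assms by (auto simp: block_def)
qed

lemma disjoint_blocks: "i \<noteq> j \<Longrightarrow> block i \<inter> block j = {}"
  using block_less[of i j] block_less[of j i] by (metis disjoint_iff less_irrefl linorder_neqE_nat)

lemma block_subset: "j < J \<Longrightarrow> block j \<subseteq> {..<(\<Sum>i<J. 4 ^ i)}"
proof -
  assume "j < J"
  then have "(\<Sum>l<Suc j. 4 ^ l) \<le> (\<Sum>l<J. 4 ^ l :: nat)"
    by (intro sum_mono2) auto
  then show ?thesis by (auto simp: block_def)
qed

lemma geometric_tail_le: "(\<Sum>l\<in>{i<..<J}. 1 / 2 ^ l :: real) \<le> 1 / 2 ^ i"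
proof (cases "i < J")
  case True
  then have "Suc i \<le> J" by simp
  then have "(\<Sum>l\<in>{i<..<J}. 1 / 2 ^ l :: real) = 1 / 2 ^ i - 2 / 2 ^ J"
  proof (induction J rule: dec_induct)
    case base
    have "{i<..<Suc i} = {}" by auto
    then show ?case by simp
  next
    case (step J)
    then have "{i<..<Suc J} = insert J {i<..<J}" by auto
    then show ?case using step by simp
  qed
  then show ?thesis by simp
qed simp

lemma geometric_tail_four_le: "(\<Sum>i\<in>{j..<J}. 1 / 4 ^ i :: real) \<le> 4 / 3 * (1 / 4 ^ j)"
proof (cases "j \<le> J")
  case True
  then have "(\<Sum>i\<in>{j..<J}. 1 / 4 ^ i :: real) = 4 / 3 * (1 / 4 ^ j - 1 / 4 ^ J)"
    by (induction J rule: dec_induct) (simp_all add: right_diff_distrib)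
  moreover have "0 \<le> 1 / (4::real) ^ J" by simp
  ultimately show ?thesis by argo
qed simp

text \<open>
  The theorem of McGehee, Pigno and Smith for coefficients \<open>1\<close>. The frequencies are listed in
  decreasing order: the exponential factors in the test function raise frequencies, so a block sum
  reaches only coefficients at or above its own frequencies. Hence the coefficient at a frequency of
  block \<open>j\<close> is \<open>1 / 4 ^ j\<close>, up to errors \<open>3 / 8 * (1 / 4 ^ i)\<close> from the blocks \<open>i \<ge> j\<close>, whose sum is
  at most half of the main term.
\<close>

theorem L1_norm_character_sum_ge:
  fixes a :: "nat \<Rightarrow> int" and n :: nat
  assumes dec: "\<And>i k. i < k \<Longrightarrow> k < n \<Longrightarrow> a k < a i" and J: "(\<Sum>i<J. 4 ^ i) \<le> n"
  shows "real J / 10 \<le> integral {0..1} (\<lambda>t. norm (\<Sum>k<n. character (a k) t))"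
proof -
  have block_n: "k < n" if "k \<in> block j" "j < J" for k j
    using block_subset[OF that(2)] that(1) J by auto
  have inj: "inj_on a {..<n}"
    by (rule inj_onI) (metis dec lessThan_iff linorder_neqE_nat order_less_irrefl)
  define f where "f = (\<lambda>i t. 1 / 4 ^ i * (\<Sum>m\<in>block i. character (a m) t))"
  have f_trig: "trig_poly (f i)" for i
    unfolding f_def sum_distrib_left by (intro trig_poly_sum trig_poly.monomial)
  note f_cont [continuous_intros] = continuous_on_trig_poly[OF f_trig]
  have f_le: "norm (f i t) \<le> 1" for i t
  proof -
    have "norm (\<Sum>m\<in>block i. character (a m) t) \<le> (\<Sum>m\<in>block i. 1)"
      by (rule sum_norm_le) simp
    then show ?thesis by (simp add: f_def norm_mult norm_divide norm_power card_block)
  qed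
  have f_L2: "integral {0..1} (\<lambda>t. (norm (f i t))\<^sup>2) = 1 / 4 ^ i" if "i < J" for i
  proof -
    have "inj_on a (block i)"
      using inj block_n[OF _ that] by (blast intro: inj_on_subset)
    then have "integral {0..1} (\<lambda>t. (norm (\<Sum>m\<in>block i. character (a m) t))\<^sup>2) = 4 ^ i"
      by (simp add: integral_norm_square_character_sum card_block)
    then show ?thesis
      by (simp add: f_def norm_mult norm_divide norm_power power_mult_distrib power_divide power2_eq_square)
  qed
  \<comment> \<open>The error \<open>1 / 4 / 4 ^ i\<close> turns the bound \<open>2 / 4 ^ i\<close> into the perfect square \<open>9 / 4 / 4 ^ i\<close>.\<close>
  have "\<exists>h. h holomorphic_on UNIV \<and> (\<forall>t. norm (f i t) \<le> Re (h (circ t))) \<and>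
      integral {0..1} (\<lambda>t. (norm (h (circ t)))\<^sup>2) \<le> 2 * integral {0..1} (\<lambda>t. (norm (f i t))\<^sup>2) + 1 / 4 / 4 ^ i" for i
    by (rule analytic_majorant[OF f_trig f_le, of "1 / 4 / 4 ^ i"]) (simp, blast)
  then obtain h where h_hol: "\<And>i. h i holomorphic_on UNIV" and h_Re: "\<And>i t. norm (f i t) \<le> Re (h i (circ t))"
    and h_L2': "\<And>i. integral {0..1} (\<lambda>t. (norm (h i (circ t)))\<^sup>2) \<le> 2 * integral {0..1} (\<lambda>t. (norm (f i t))\<^sup>2) + 1 / 4 / 4 ^ i"
    by metis
  note h_cont [continuous_intros] = continuous_on_entire_circ[OF h_hol]
  have h_L2: "integral {0..1} (\<lambda>t. (norm (h i (circ t)))\<^sup>2) \<le> (3 / 2 * (1 / 2 ^ i))\<^sup>2" if "i < J" for i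
    using h_L2'[of i] f_L2[OF that] by (simp add: power_mult_distrib power_divide flip: power_mult) (simp add: power_mult mult.commute[of i])
  define G where "G = (\<lambda>i u. exp (- (\<Sum>l\<in>{i<..<J}. h l u) / 4))"
  have G_hol: "G i holomorphic_on UNIV" for i
    unfolding G_def by (intro holomorphic_intros h_hol) auto
  note G_cont [continuous_intros] = continuous_on_entire_circ[OF G_hol]
  define F where "F = (\<lambda>t. \<Sum>i<J. f i t * G i (circ t))"
  have F_cont [continuous_intros]: "continuous_on UNIV F"
    unfolding F_def by (intro continuous_intros)
  have F_le: "norm (F t) \<le> 5" for t
    unfolding F_def G_def by (rule norm_damped_sum_le) (auto simp: f_le h_Re)
  \<comment> \<open>The contribution of the block \<open>i\<close> to the Fourier coefficient of \<open>F\<close> at the frequency \<open>a k\<close>.\<close>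
  define c where "c = (\<lambda>i k. integral {0..1} (\<lambda>t. f i t * G i (circ t) * character (- a k) t))"
  have c_zero: "c i k = 0" if "\<And>m. m \<in> block i \<Longrightarrow> a k < a m" for i k
  proof -
    have "c i k = integral {0..1} (\<lambda>t. \<Sum>m\<in>block i. 1 / 4 ^ i * (character (a m - a k) t * G i (circ t)))"
      unfolding c_def
    proof (rule integral_cong)
      fix t
      have "f i t * G i (circ t) * character (- a k) t
          = (\<Sum>m\<in>block i. 1 / 4 ^ i * ((character (a m) t * character (- a k) t) * G i (circ t)))"
        unfolding f_def sum_distrib_left sum_distrib_right by (intro sum.cong refl) (simp only: mult_ac)
      then show "f i t * G i (circ t) * character (- a k) t
          = (\<Sum>m\<in>block i. 1 / 4 ^ i * (character (a m - a k) t * G i (circ t)))"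
        by (simp add: character_mult)
    qed
    also have "\<dots> = (\<Sum>m\<in>block i. integral {0..1} (\<lambda>t. 1 / 4 ^ i * (character (a m - a k) t * G i (circ t))))"
      by (intro integral_sum finite_block integrable_01 continuous_intros)
    also have "\<dots> = 0"
      using that by (intro sum.neutral ballI) (simp add: integral_character_entire G_hol)
    finally show ?thesis .
  qed
  have f_coeff: "integral {0..1} (\<lambda>t. f i t * character (- a k) t) = (if k \<in> block i then 1 / 4 ^ i else 0)"
    if "i < J" "k < n" for i k
  proof -
    have "integral {0..1} (\<lambda>t. f i t * character (- a k) t)
        = integral {0..1} (\<lambda>t. \<Sum>m\<in>block i. 1 / 4 ^ i * character (a m - a k) t)"
      by (simp add: f_def sum_distrib_left sum_distrib_right mult.assoc character_mult)
    also have "\<dots> = (\<Sum>m\<in>block i. 1 / 4 ^ i * integral {0..1} (character (a m - a k)))"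
      by (subst integral_sum) (intro integrable_01 continuous_intros finite_block | simp)+
    also have "\<dots> = (\<Sum>m\<in>block i. if m = k then 1 / 4 ^ i else 0)"
      using block_n that inj by (intro sum.cong refl) (auto simp: integral_character inj_on_def)
    finally show ?thesis by simp
  qed
  have c_near: "norm (c i k - (if k \<in> block i then 1 / 4 ^ i else 0)) \<le> 3 / 8 * (1 / 4 ^ i)" if "i < J" "k < n" for i k
  proof -
    have "c i k - integral {0..1} (\<lambda>t. f i t * character (- a k) t)
        = integral {0..1} (\<lambda>t. f i t * G i (circ t) * character (- a k) t - f i t * character (- a k) t)"
      unfolding c_def by (rule integral_diff[symmetric]) (intro integrable_01 continuous_intros)+
    also have "norm \<dots> \<le> integral {0..1} (\<lambda>t. norm (f i t) * norm (G i (circ t) - 1))"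
    proof (rule integral_norm_bound_integral)
      fix t
      have "f i t * G i (circ t) * character (- a k) t - f i t * character (- a k) t
         = f i t * (G i (circ t) - 1) * character (- a k) t" by (simp add: algebra_simps)
      then show "norm (f i t * G i (circ t) * character (- a k) t - f i t * character (- a k) t)
          \<le> norm (f i t) * norm (G i (circ t) - 1)" by (simp add: norm_mult)
    qed (intro integrable_01 continuous_intros)+
    also have "\<dots> \<le> (1 / 2 ^ i) / 4 * (\<Sum>l\<in>{i<..<J}. 3 / 2 * (1 / 2 ^ l))"
      unfolding G_def
    proof (rule integral_exp_perturbation_le)
      show "0 \<le> Re (h l (circ t))" for l t
        using h_Re[of l t] norm_ge_zero order_trans by blast
      show "integral {0..1} (\<lambda>t. (norm (f i t))\<^sup>2) \<le> (1 / 2 ^ i)\<^sup>2"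
        using f_L2[OF that(1)] by (simp add: power_divide flip: power_mult) (simp add: power_mult mult.commute[of i])
      show "integral {0..1} (\<lambda>t. (norm (h l (circ t)))\<^sup>2) \<le> (3 / 2 * (1 / 2 ^ l))\<^sup>2" if "l \<in> {i<..<J}" for l
        using that by (intro h_L2) simp
    qed (auto intro!: continuous_intros)
    also have "\<dots> \<le> (1 / 2 ^ i) / 4 * (3 / 2 * (1 / 2 ^ i))"
      unfolding sum_distrib_left[symmetric] by (intro mult_left_mono geometric_tail_le) simp_all
    also have "(1 / 2 ^ i) / 4 * (3 / 2 * (1 / 2 ^ i)) = 3 / 8 * (1 / 4 ^ i :: real)"
      by (simp flip: power_mult_distrib)
    finally show ?thesis using f_coeff[OF that] by simp
  qed
  have coeff_block: "1 / 2 * (1 / 4 ^ j) \<le> Re (\<Sum>i<J. c i k)" if k: "k \<in> block j" and j: "j < J" for k j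
  proof -
    have kn: "k < n" using block_n k j .
    have below: "c i k = 0" if "i < j" for i
      using that block_less[OF _ _ k] kn by (intro c_zero dec) auto
    have "(\<Sum>i<J. c i k) = (\<Sum>i\<in>{j..<J}. c i k)"
      using below by (intro sum.mono_neutral_right) auto
    moreover have "(\<Sum>i\<in>{j..<J}. (if k \<in> block i then 1 / 4 ^ i else 0)) = (1 / 4 ^ j :: complex)"
    proof -
      have "k \<in> block i \<longleftrightarrow> i = j" for i using disjoint_blocks[of i j] k by blast
      then show ?thesis using j by simp
    qed
    ultimately have "(\<Sum>i<J. c i k) - 1 / 4 ^ j = (\<Sum>i\<in>{j..<J}. c i k - (if k \<in> block i then 1 / 4 ^ i else 0))"
      by (simp add: sum_subtractf)
    also have "norm \<dots> \<le> (\<Sum>i\<in>{j..<J}. 3 / 8 * (1 / 4 ^ i))"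
      using c_near kn by (intro sum_norm_le) auto
    also have "\<dots> \<le> 1 / 2 * (1 / 4 ^ j)"
      unfolding sum_distrib_left[symmetric] using geometric_tail_four_le[of j J] by argo
    finally have "norm ((\<Sum>i<J. c i k) - 1 / 4 ^ j) \<le> 1 / 2 * (1 / 4 ^ j)" .
    moreover have "1 / 4 ^ j - Re (\<Sum>i<J. c i k) \<le> norm ((\<Sum>i<J. c i k) - 1 / 4 ^ j)"
    proof -
      have "(1 / 4 ^ j :: complex) = of_real (1 / 4 ^ j)" by simp
      then show ?thesis using abs_Re_le_cmod[of "(\<Sum>i<J. c i k) - 1 / 4 ^ j"]
        by (smt (verit) Re_complex_of_real minus_complex.simps(1))
    qed
    ultimately show ?thesis by linarith
  qed
  \<comment> \<open>The frequencies left over by the blocks are the lowest ones, which \<open>F\<close> does not reach.\<close>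
  have coeff_rest: "Re (\<Sum>i<J. c i k) = 0" if "k < n" "\<And>j. j < J \<Longrightarrow> k \<notin> block j" for k
  proof -
    have "(\<Sum>i<J. 4 ^ i) \<le> k"
      using that(2)
    proof (induction J)
      case (Suc J)
      then show ?case by (simp add: block_def) (metis (no_types, lifting) add.commute less_Suc_eq not_less)
    qed simp
    then have "c i k = 0" if "i < J" for i
      using block_subset[OF that] \<open>k < n\<close> by (intro c_zero dec) auto
    then show ?thesis by simp
  qed
  have "real J / 2 = (\<Sum>j<J. \<Sum>k\<in>block j. 1 / 2 * (1 / 4 ^ j))"
    by (simp add: card_block)
  also have "\<dots> \<le> (\<Sum>j<J. \<Sum>k\<in>block j. Re (\<Sum>i<J. c i k))"
    by (intro sum_mono coeff_block) auto
  also have "\<dots> = (\<Sum>k\<in>(\<Union>j<J. block j). Re (\<Sum>i<J. c i k))"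
    using disjoint_blocks by (intro sum.UNION_disjoint[symmetric]) auto
  also have "\<dots> = (\<Sum>k<n. Re (\<Sum>i<J. c i k))"
    using block_n coeff_rest by (intro sum.mono_neutral_left) auto
  also have "\<dots> = Re (\<Sum>k<n. \<Sum>i<J. c i k)" by simp
  also have "(\<Sum>k<n. \<Sum>i<J. c i k) = (\<Sum>k<n. integral {0..1} (\<lambda>t. F t * character (- a k) t))"
    unfolding c_def F_def sum_distrib_right
    by (intro sum.cong refl integral_sum[symmetric] integrable_01 continuous_intros) simp
  also have "\<dots> = integral {0..1} (\<lambda>t. \<Sum>k<n. F t * character (- a k) t)"
    by (intro integral_sum[symmetric] integrable_01 continuous_intros) simp
  also have "Re \<dots> \<le> norm \<dots>" by (rule complex_Re_le_cmod)
  also have "\<dots> \<le> integral {0..1} (\<lambda>t. 5 * norm (\<Sum>k<n. character (a k) t))"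
  proof (rule integral_norm_bound_integral)
    fix t
    have "(\<Sum>k<n. F t * character (- a k) t) = F t * cnj (\<Sum>k<n. character (a k) t)"
      by (simp add: sum_distrib_left cnj_character)
    then show "norm (\<Sum>k<n. F t * character (- a k) t) \<le> 5 * norm (\<Sum>k<n. character (a k) t)"
      using F_le[of t] by (simp add: norm_mult mult_right_mono del: cnj_sum)
  qed (intro integrable_01 continuous_intros)+
  finally show ?thesis by simp
qed

corollary L1_norm_character_sum_set_ge:
  assumes A: "finite A" and J: "(\<Sum>i<J. 4 ^ i) \<le> card A"
  shows "real J / 10 \<le> integral {0..1} (\<lambda>t. norm (\<Sum>x\<in>A. character x t))"
proof -
  define xs where "xs = rev (sorted_list_of_set A)"
  have xs: "distinct xs" "set xs = A" "length xs = card A"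
    using A by (simp_all add: xs_def)
  have "real J / 10 \<le> integral {0..1} (\<lambda>t. norm (\<Sum>k<card A. character (xs ! k) t))"
  proof (rule L1_norm_character_sum_ge[OF _ J])
    fix i k assume "i < k" "k < card A"
    moreover have "sorted_wrt (>) xs"
      unfolding xs_def sorted_wrt_rev by simp
    ultimately show "xs ! k < xs ! i"
      by (metis sorted_wrt_iff_nth_less xs(3))
  qed
  moreover have "(\<Sum>k<card A. character (xs ! k) t) = (\<Sum>x\<in>A. character x t)" for t
    using bij_betw_nth[OF xs(1) _ xs(2)[symmetric], of "{..<card A}"] xs(3)
    by (intro sum.reindex_bij_betw) auto
  ultimately show ?thesis by simp
qed

text \<open>
  If \<open>g \<ge> - c\<close> for a real \<open>g\<close>, then \<open>\<bar>g\<bar> \<le> g + 2 c\<close>, so the \<open>L\<^sup>1\<close> norm is at most the mean, which is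
  \<open>0\<close> or \<open>1\<close> according to whether the frequency \<open>0\<close> occurs, plus \<open>2 c\<close>.
\<close>

lemma exists_character_sum_less:
  assumes A: "finite A" and J: "(\<Sum>i<J. 4 ^ i) \<le> card A"
    and real: "\<And>t. (\<Sum>x\<in>A. character x t) \<in> \<real>" and c: "0 \<le> c" "1 + 2 * c < real J / 10"
  shows "\<exists>t. Re (\<Sum>x\<in>A. character x t) < - c"
proof (rule ccontr)
  let ?f = "\<lambda>t. \<Sum>x\<in>A. character x t"
  assume "\<nexists>t. Re (?f t) < - c"
  then have ge: "- c \<le> Re (?f t)" for t by (meson not_less)
  have [continuous_intros]: "continuous_on UNIV ?f"
    by (intro continuous_intros)
  have "integral {0..1} (\<lambda>t. Re (?f t)) = Re (integral {0..1} ?f)"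
    by (rule integral_linear[OF integrable_01 bounded_linear_Re, unfolded o_def]) (intro continuous_intros)
  also have "integral {0..1} ?f = (\<Sum>x\<in>A. if x = 0 then 1 else 0)"
    by (subst integral_sum[OF A]) (intro integrable_01 continuous_intros | simp add: integral_character)+
  also have "Re \<dots> \<le> 1" using A by simp
  finally have mean: "integral {0..1} (\<lambda>t. Re (?f t)) \<le> 1" .
  have "integral {0..1} (\<lambda>t. norm (?f t)) \<le> integral {0..1} (\<lambda>t. Re (?f t) + 2 * c)"
  proof (rule integral_le)
    fix t
    have "norm (?f t) = \<bar>Re (?f t)\<bar>" using real[of t] by (rule in_Reals_norm)
    then show "norm (?f t) \<le> Re (?f t) + 2 * c" using ge[of t] c(1) by linarith
  qed (intro integrable_01 continuous_intros)+
  also have "\<dots> = integral {0..1} (\<lambda>t. Re (?f t)) + 2 * c"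
    by (subst integral_add) (intro integrable_01 continuous_intros | simp)+
  finally have "real J / 10 \<le> 1 + 2 * c"
    using mean L1_norm_character_sum_set_ge[OF A J] by linarith
  then show False using c by linarith
qed

section \<open>The elementary bound by second moments\<close>

lemma norm_geometric_sum_le:
  fixes w :: complex
  assumes "norm w = 1" "w \<noteq> 1"
  shows "norm (\<Sum>k<K. w ^ k) \<le> 2 / norm (1 - w)"
proof -
  have "(\<Sum>k<K. w ^ k) = (1 - w ^ K) / (1 - w)"
    using assms by (simp add: sum_gp_strict)
  moreover have "norm (1 - w ^ K) \<le> 2"
    using norm_triangle_ineq4[of 1 "w ^ K"] assms by (simp add: norm_power)
  ultimately show ?thesis by (simp add: norm_divide divide_right_mono)
qed

text \<open>
  Summing \<open>(f k + c) (n - f k) \<ge> 0\<close> over \<open>k < K\<close> and comparing the terms of order \<open>K\<close> gives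
  \<open>n (1 - c) \<le> 0\<close>. The other terms are geometric sums with ratios \<open>z\<^sub>j\<close> and \<open>z\<^sub>i * cnj z\<^sub>j\<close> for
  \<open>i \<noteq> j\<close>. As these ratios differ from \<open>1\<close>, their sums stay bounded.
\<close>

lemma exists_power_sum_less:
  assumes n: "n > 0" and inj: "inj_on z {1..n}"
    and norm: "\<And>i. i \<in> {1..n} \<Longrightarrow> norm (z i) = 1"
    and ne1: "\<And>i. i \<in> {1..n} \<Longrightarrow> z i \<noteq> 1"
    and cnj: "\<And>i. i \<in> {1..n} \<Longrightarrow> z (n + 1 - i) = cnj (z i)"
    and c: "c < 1"
  shows "\<exists>k. Re (power_sum n z k) < - c"
proof (rule ccontr)
  define f where "f = (\<lambda>k::nat. Re (power_sum n z (int k)))"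
  assume "\<nexists>k. Re (power_sum n z k) < - c"
  then have ge: "- c \<le> f k" for k by (auto simp: f_def not_less)
  have ps: "power_sum n z (int k) = (\<Sum>j=1..n. z j ^ k)" for k
    by (simp add: power_sum_def)
  have f_complex: "of_real (f k) = (\<Sum>j=1..n. z j ^ k)" for k
  proof -
    have "power_sum n z (int k) \<in> \<real>"
      using cnj by (rule power_sum_real)
    then show ?thesis unfolding f_def by (simp only: of_real_Re ps)
  qed
  have f_le: "f k \<le> n" for k
  proof -
    have "norm (\<Sum>j=1..n. z j ^ k) \<le> (\<Sum>j=1..n. 1)"
      using norm by (intro sum_norm_le) (simp add: norm_power)
    then show ?thesis using complex_Re_le_cmod[of "\<Sum>j=1..n. z j ^ k"] by (simp add: f_def ps)
  qed
  define P where "P = (SIGMA i:{1..n}. {1..n} - {i})"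
  define C1 where "C1 = (\<Sum>j=1..n. 2 / norm (1 - z j))"
  define C2 where "C2 = (\<Sum>(i,j)\<in>P. 2 / norm (1 - z i * cnj (z j)))"
  have mean: "(\<Sum>k<K. f k) \<le> C1" for K
  proof -
    have "of_real (\<Sum>k<K. f k) = (\<Sum>j=1..n. \<Sum>k<K. z j ^ k)"
      unfolding of_real_sum f_complex by (rule sum.swap)
    also have "norm \<dots> \<le> C1"
      unfolding C1_def using norm ne1 by (intro sum_norm_le norm_geometric_sum_le) auto
    finally show ?thesis unfolding norm_of_real by linarith
  qed
  have square: "n * K - C2 \<le> (\<Sum>k<K. (f k)\<^sup>2)" for K
  proof -
    have sq: "of_real ((f k)\<^sup>2) = of_nat n + (\<Sum>(i,j)\<in>P. (z i * cnj (z j)) ^ k)" for k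
    proof -
      have "of_real ((f k)\<^sup>2) = of_real (f k) * cnj (of_real (f k))"
        by (simp add: power2_eq_square)
      also have "\<dots> = (\<Sum>i=1..n. \<Sum>j=1..n. (z i * cnj (z j)) ^ k)"
        unfolding f_complex by (simp add: sum_product power_mult_distrib)
      also have "\<dots> = (\<Sum>i=1..n. 1 + (\<Sum>j\<in>{1..n}-{i}. (z i * cnj (z j)) ^ k))"
      proof (rule sum.cong[OF refl])
        fix i assume i: "i \<in> {1..n}"
        then have "z i * cnj (z i) = 1" using norm[OF i] by (simp flip: complex_norm_square)
        then show "(\<Sum>j=1..n. (z i * cnj (z j)) ^ k) = 1 + (\<Sum>j\<in>{1..n}-{i}. (z i * cnj (z j)) ^ k)"
          using i by (subst sum.remove[of _ i]) auto
      qed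
      also have "\<dots> = of_nat n + (\<Sum>i=1..n. \<Sum>j\<in>{1..n}-{i}. (z i * cnj (z j)) ^ k)"
        by (simp add: sum.distrib)
      also have "(\<Sum>i=1..n. \<Sum>j\<in>{1..n}-{i}. (z i * cnj (z j)) ^ k) = (\<Sum>(i,j)\<in>P. (z i * cnj (z j)) ^ k)"
        unfolding P_def by (intro sum.Sigma) auto
      finally show ?thesis .
    qed
    have "of_real ((\<Sum>k<K. (f k)\<^sup>2) - n * K) = (\<Sum>k<K. \<Sum>(i,j)\<in>P. (z i * cnj (z j)) ^ k)"
      unfolding of_real_diff of_real_sum sq by (simp add: sum.distrib mult.commute)
    also have "\<dots> = (\<Sum>p\<in>P. \<Sum>k<K. case p of (i,j) \<Rightarrow> (z i * cnj (z j)) ^ k)"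
      by (rule sum.swap)
    also have "norm \<dots> \<le> C2"
      unfolding C2_def
    proof (rule sum_norm_le)
      fix p assume "p \<in> P"
      obtain i j where ij: "p = (i, j)" by (cases p)
      with \<open>p \<in> P\<close> have p: "p = (i, j)" "i \<in> {1..n}" "j \<in> {1..n}" "i \<noteq> j" by (simp_all add: P_def)
      have "z i * cnj (z j) \<noteq> 1"
      proof
        assume "z i * cnj (z j) = 1"
        then have "z i * (cnj (z j) * z j) = z j" by (metis mult.assoc mult_1)
        moreover have "cnj (z j) * z j = 1"
          using norm[OF p(3)] by (simp add: mult.commute flip: complex_norm_square)
        ultimately have "z i = z j" by simp
        then show False using inj p by (auto dest: inj_onD)
      qed
      then show "norm (\<Sum>k<K. case p of (i,j) \<Rightarrow> (z i * cnj (z j)) ^ k) \<le> (case p of (i,j) \<Rightarrow> 2 / norm (1 - z i * cnj (z j)))"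
        using norm p by (simp add: norm_geometric_sum_le norm_mult)
    qed
    finally show ?thesis unfolding norm_of_real by linarith
  qed
  have "real K * (n * (1 - c)) \<le> (n - c) * C1 + C2" for K
  proof -
    have "0 \<le> (\<Sum>k<K. (f k + c) * (n - f k))"
    proof (intro sum_nonneg mult_nonneg_nonneg)
      fix k show "0 \<le> f k + c" "0 \<le> n - f k" using ge[of k] f_le[of k] by simp_all
    qed
    also have "\<dots> = (\<Sum>k<K. (n - c) * f k + (n * c - (f k)\<^sup>2))"
      by (intro sum.cong) (simp_all add: algebra_simps power2_eq_square)
    also have "\<dots> = (n - c) * (\<Sum>k<K. f k) + (K * (n * c) - (\<Sum>k<K. (f k)\<^sup>2))"
      by (simp add: sum.distrib sum_subtractf sum_distrib_left)
    also have "\<dots> \<le> (n - c) * C1 + (K * (n * c) - (n * K - C2))"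
      using mean square c n by (intro add_mono mult_left_mono diff_left_mono) auto
    finally show ?thesis by (simp add: algebra_simps)
  qed
  moreover have "real n * (1 - c) > 0" using n c by simp
  then obtain K where "(n - c) * C1 + C2 < real K * (n * (1 - c))"
    using reals_Archimedean3 by blast
  ultimately show False by (metis not_less)
qed

section \<open>Simultaneous approximation of characters by powers\<close>

lemma norm_cis_minus_one_le: "norm (cis x - 1) \<le> \<bar>x\<bar>"
  using norm_exp_minus_one_le[of "\<i> * of_real x"] by (simp add: cis_conv_exp norm_mult)

text \<open>
  The instance of linear independence over the integers that occurs in Kronecker's theorem.
\<close>

interpretation int_reals: module "\<lambda>(r::int) (x::real). of_int r * x"
  by unfold_locales (auto simp: algebra_simps)

text \<open>
  Let \<open>B\<close> be a maximal subset of \<open>T\<close> that together with \<open>1\<close> is independent over the integers. By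
  maximality each \<open>x\<close> in \<open>T\<close> satisfies a nontrivial integer relation with \<open>1\<close> and \<open>B\<close>, in which its own
  coefficient cannot vanish. The product of these coefficients is a common denominator \<open>M\<close>.
\<close>

lemma int_independent_coordinates:
  fixes T :: "real set"
  assumes T: "finite T"
  shows "\<exists>B M p u. B \<subseteq> T \<and> 1 \<notin> B \<and> int_reals.independent (insert 1 B) \<and> M \<noteq> 0 \<and>
    (\<forall>x\<in>T. of_int M * x = of_int (p x) + (\<Sum>b\<in>B. of_int (u x b) * b))"
proof -
  let ?\<B> = "{B \<in> Pow T. 1 \<notin> B \<and> int_reals.independent (insert 1 B)}"
  have "int_reals.independent {1}"
    by (subst int_reals.dependent_finite) auto
  then have "{} \<in> ?\<B>" by simp
  moreover have "finite ?\<B>" using T by simp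
  ultimately have "\<exists>B\<in>?\<B>. \<forall>C\<in>?\<B>. B \<le> C \<longrightarrow> B = C"
    by (intro finite_has_maximal) auto
  then obtain B where B: "B \<in> ?\<B>" and max: "\<And>C. C \<in> ?\<B> \<Longrightarrow> B \<subseteq> C \<Longrightarrow> B = C"
    by (elim bexE) (rule that, assumption, simp)
  have fin: "finite B" using B T finite_subset by auto
  have "\<exists>m p u. m \<noteq> 0 \<and> of_int m * x = of_int p + (\<Sum>b\<in>B. of_int (u b) * b)" if x: "x \<in> T" for x
  proof -
    consider "x = 1" | "x \<in> B" | "x \<noteq> 1" "x \<notin> B" by blast
    then show ?thesis
    proof cases
      case 1
      then show ?thesis by (intro exI[of _ 1] exI[of _ "\<lambda>_. 0"]) simp
    next
      case 2
      have "(\<Sum>b\<in>B. of_int (if b = x then 1 else 0) * b) = (\<Sum>b\<in>B. if b = x then b else 0)"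
        by (intro sum.cong) auto
      then show ?thesis using 2 fin by (intro exI[of _ 1] exI[of _ 0] exI[of _ "\<lambda>b. if b = x then 1 else 0"]) simp
    next
      case 3
      then have "insert x B \<notin> ?\<B>" using max[of "insert x B"] by blast
      then have "int_reals.dependent (insert x (insert 1 B))"
        using x 3 B by (simp add: insert_commute[of x 1 B])
      then obtain v where v: "\<exists>b\<in>insert x (insert 1 B). v b \<noteq> 0"
        and sum0: "(\<Sum>b\<in>insert x (insert 1 B). of_int (v b) * b) = 0"
        using int_reals.dependent_finite[of "insert x (insert 1 B)"] fin by auto
      have eq: "of_int (v x) * x + (of_int (v 1) + (\<Sum>b\<in>B. of_int (v b) * b)) = 0"
        using sum0 3 B fin by simp
      have "v x \<noteq> 0"
      proof
        assume 0: "v x = 0"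
        then have "(\<Sum>b\<in>insert 1 B. of_int (v b) * b) = 0" using eq B fin by simp
        then have "int_reals.dependent (insert 1 B)"
          using v 0 fin by (subst int_reals.dependent_finite) auto
        then show False using B by simp
      qed
      moreover have "of_int (v x) * x = of_int (- v 1) + (\<Sum>b\<in>B. of_int (- v b) * b)"
        using eq by (simp add: sum_negf)
      ultimately show ?thesis
        by (intro exI[of _ "v x"] exI[of _ "- v 1"] exI[of _ "\<lambda>b. - v b"] conjI)
    qed
  qed
  then have "\<forall>x\<in>T. \<exists>m p u. m \<noteq> 0 \<and> of_int m * x = of_int p + (\<Sum>b\<in>B. of_int (u b) * b)" by blast
  then obtain m p u where m: "\<And>x. x \<in> T \<Longrightarrow> m x \<noteq> 0"
    and coord: "\<And>x. x \<in> T \<Longrightarrow> of_int (m x) * x = of_int (p x) + (\<Sum>b\<in>B. of_int (u x b) * b)"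
    unfolding bchoice_iff by blast
  show ?thesis
  proof (intro exI[of _ B] exI[of _ "prod m T"] exI[of _ "\<lambda>x. prod m (T - {x}) * p x"]
      exI[of _ "\<lambda>x b. prod m (T - {x}) * u x b"] conjI ballI)
    show "prod m T \<noteq> 0" using m T by simp
    fix x assume x: "x \<in> T"
    then have "of_int (prod m T) * x = of_int (prod m (T - {x})) * (of_int (m x) * x)"
      using T by (simp add: prod.remove mult_ac)
    also have "\<dots> = of_int (prod m (T - {x}) * p x) + (\<Sum>b\<in>B. of_int (prod m (T - {x}) * u x b) * b)"
      by (simp only: coord[OF x] distrib_left sum_distrib_left of_int_mult mult.assoc)
    finally show "of_int (prod m T) * x = of_int (prod m (T - {x}) * p x) + (\<Sum>b\<in>B. of_int (prod m (T - {x}) * u x b) * b)" .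
  qed (use B in auto)
qed

text \<open>
  Regard the rows as coefficients of integer polynomials: the differences have only finitely many
  roots altogether, and any other integer \<open>X\<close> separates the rows.
\<close>

lemma separating_int:
  fixes U :: "'a \<Rightarrow> nat \<Rightarrow> int"
  assumes I: "finite I" and sep: "\<And>i j. i \<in> I \<Longrightarrow> j \<in> I \<Longrightarrow> i \<noteq> j \<Longrightarrow> \<exists>s<r. U i s \<noteq> U j s"
  shows "\<exists>X. inj_on (\<lambda>i. \<Sum>s<r. U i s * X ^ s) I"
proof -
  define P where "P = (\<lambda>i. \<Sum>s<r. monom (U i s) s)"
  have poly_P: "poly (P i) X = (\<Sum>s<r. U i s * X ^ s)" for i X
    by (simp add: P_def poly_sum poly_monom)
  have coeff_P: "coeff (P i) s = U i s" if "s < r" for i s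
    using that by (simp add: P_def coeff_sum)
  have ne: "P i - P j \<noteq> 0" if "i \<in> I" "j \<in> I" "i \<noteq> j" for i j
    using sep[OF that] coeff_P by (metis right_minus_eq)
  have "finite (\<Union>(i,j)\<in>{(i,j). i \<in> I \<and> j \<in> I \<and> i \<noteq> j}. {X. poly (P i - P j) X = 0})"
  proof (rule finite_UN_I)
    show "finite {(i,j). i \<in> I \<and> j \<in> I \<and> i \<noteq> j}"
      by (rule finite_subset[of _ "I \<times> I"]) (use I in auto)
    show "finite (case q of (i, j) \<Rightarrow> {X. poly (P i - P j) X = 0})"
      if "q \<in> {(i,j). i \<in> I \<and> j \<in> I \<and> i \<noteq> j}" for q
    proof (cases q)
      case (Pair i j)
      then have "i \<in> I" "j \<in> I" "i \<noteq> j" using that by simp_all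
      then show ?thesis using poly_roots_finite[OF ne] unfolding Pair by (simp only: prod.case)
    qed
  qed
  then obtain X where X: "X \<notin> (\<Union>(i,j)\<in>{(i,j). i \<in> I \<and> j \<in> I \<and> i \<noteq> j}. {X. poly (P i - P j) X = 0})"
    using ex_new_if_finite[OF infinite_UNIV_int] by blast
  have "inj_on (\<lambda>i. poly (P i) X) I"
    using X by (auto intro!: inj_onI)
  then show ?thesis unfolding poly_P by blast
qed

text \<open>
  Write \<open>M \<theta>\<^sub>j = p\<^sub>j + (\<Sum>s. U\<^sub>j\<^sub>s g\<^sub>s)\<close> for the arguments \<open>\<theta>\<^sub>j\<close> of the \<open>z\<^sub>j\<close>, where \<open>1\<close> and the \<open>g\<^sub>s\<close> are
  independent over the integers. By Kronecker's theorem some integer \<open>k\<close> makes all \<open>k g\<^sub>s\<close> close to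
  \<open>t X ^ s\<close> modulo \<open>1\<close>, and then \<open>z\<^sub>j powi (k M)\<close> is close to the character of frequency
  \<open>a\<^sub>j = (\<Sum>s. U\<^sub>j\<^sub>s X ^ s)\<close>. Two arguments with the same coordinates \<open>U\<close> would have a quotient \<open>z\<^sub>i / z\<^sub>j\<close>
  of order dividing \<open>M\<close>, so for suitable \<open>X\<close> the \<open>a\<^sub>j\<close> are distinct.
\<close>

theorem powers_approximate_characters:
  fixes z :: "'a \<Rightarrow> complex"
  assumes I: "finite I" and norm: "\<And>j. j \<in> I \<Longrightarrow> norm (z j) = 1"
    and ratio: "\<And>i j. i \<in> I \<Longrightarrow> j \<in> I \<Longrightarrow> i \<noteq> j \<Longrightarrow> \<not> is_root_of_unity (z i / z j)"
  obtains a :: "'a \<Rightarrow> int" where "inj_on a I"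
    "\<And>t \<epsilon>. \<epsilon> > 0 \<Longrightarrow> \<exists>k::int. \<forall>j\<in>I. norm (z j powi k - character (a j) t) < \<epsilon>"
proof -
  define \<theta> where "\<theta> = (\<lambda>j. Arg (z j) / (2 * pi))"
  have z: "z j = cis (2 * pi * \<theta> j)" if "j \<in> I" for j
  proof -
    have "z j \<noteq> 0" using norm[OF that] by auto
    then show ?thesis using cis_Arg[of "z j"] norm[OF that] by (simp add: \<theta>_def sgn_eq)
  qed
  have z_powi: "z j powi k = cis (2 * pi * (of_int k * \<theta> j))" if "j \<in> I" for j k
    by (simp add: z[OF that] cis_power_int mult_ac)
  obtain B M p u where B: "B \<subseteq> \<theta> ` I" "1 \<notin> B" "int_reals.independent (insert 1 B)" and M: "M \<noteq> 0"
    and coord0: "\<And>x. x \<in> \<theta> ` I \<Longrightarrow> of_int M * x = of_int (p x) + (\<Sum>b\<in>B. of_int (u x b) * b)"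
    using int_independent_coordinates[OF finite_imageI[OF I, of \<theta>]] by blast
  have "finite B" using B I finite_subset by blast
  then obtain g r where g: "bij_betw g {..<r::nat} B"
    by (metis ex_bij_betw_nat_finite atLeast0LessThan)
  define U where "U = (\<lambda>j s. u (\<theta> j) (g s))"
  have coord: "of_int M * \<theta> j = of_int (p (\<theta> j)) + (\<Sum>s<r. of_int (U j s) * g s)" if "j \<in> I" for j
    unfolding U_def using coord0[of "\<theta> j"] that sum.reindex_bij_betw[OF g, of "\<lambda>b. of_int (u (\<theta> j) b) * b"] by simp
  have "\<exists>s<r. U i s \<noteq> U j s" if ij: "i \<in> I" "j \<in> I" "i \<noteq> j" for i j
  proof (rule ccontr)
    assume "\<not> (\<exists>s<r. U i s \<noteq> U j s)"
    then have "of_int M * \<theta> i - of_int (p (\<theta> i)) = of_int M * \<theta> j - of_int (p (\<theta> j))"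
      using coord[OF ij(1)] coord[OF ij(2)] by simp
    then have "of_int M * \<theta> i = of_int M * \<theta> j + of_int (p (\<theta> i) - p (\<theta> j))" by simp
    then have "z i powi M = z j powi M"
      by (simp add: z_powi ij distrib_left cis_mult[symmetric] cis_multiple_2pi)
    then have "(z i / z j) powi M = 1"
      using z[OF ij(2)] by (simp add: power_int_divide_distrib)
    then have "(z i / z j) powi \<bar>M\<bar> = 1"
      by (cases "M \<ge> 0") (auto simp: power_int_minus)
    then have "(z i / z j) ^ nat \<bar>M\<bar> = 1"
      by (simp add: power_int_def)
    then have "is_root_of_unity (z i / z j)"
      unfolding is_root_of_unity_def using M by (intro exI[of _ "nat \<bar>M\<bar>"]) simp
    then show False using ratio ij by blast
  qed
  then obtain X where X: "inj_on (\<lambda>j. \<Sum>s<r. U j s * X ^ s) I"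
    using separating_int[OF I, of r U] by blast
  define a where "a = (\<lambda>j. \<Sum>s<r. U j s * X ^ s)"
  have "\<exists>k::int. \<forall>j\<in>I. norm (z j powi k - character (a j) t) < \<epsilon>" if \<epsilon>: "\<epsilon> > 0" for t \<epsilon>
  proof -
    define W where "W = (\<Sum>j\<in>I. \<Sum>s<r. \<bar>real_of_int (U j s)\<bar>)"
    have W0: "W \<ge> 0" unfolding W_def by (intro sum_nonneg) auto
    define \<delta> where "\<delta> = \<epsilon> / (2 * pi * (1 + W))"
    have \<delta>: "\<delta> > 0" using \<epsilon> W0 by (simp add: \<delta>_def)
    \<comment> \<open>Kronecker's theorem expects the number \<open>1\<close> at the last index.\<close>
    define \<Theta> where "\<Theta> = (\<lambda>s. if s = r then 1 else g s)"
    have "{..r} = insert r {..<r}" by auto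
    then have "\<Theta> ` {..r} = insert 1 B"
      using bij_betw_imp_surj_on[OF g] by (auto simp: \<Theta>_def)
    then have ind: "int_reals.independent (\<Theta> ` {..r})" using B(3) by simp
    have inj: "inj_on \<Theta> {..r}"
    proof -
      have "g s \<noteq> 1" if "s < r" for s using bij_betw_apply[OF g, of s] that B(2) by auto
      then show ?thesis
        using bij_betw_imp_inj_on[OF g] unfolding \<Theta>_def inj_on_def by (auto simp: le_less)
    qed
    have \<Theta>_r: "\<Theta> r = 1" by (simp add: \<Theta>_def)
    obtain k m where km: "\<And>s. s < r \<Longrightarrow> \<bar>of_int k * \<Theta> s - of_int (m s) - t * of_int X ^ s\<bar> < \<delta>"
    proof (rule Kronecker_thm_2[where \<alpha> = "\<lambda>s. t * of_int X ^ s", OF ind inj \<Theta>_r \<delta>])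
      fix k m
      assume "\<And>s. s < r \<Longrightarrow> \<bar>of_int k * \<Theta> s - of_int (m s) - t * of_int X ^ s\<bar> < \<delta>"
      then show thesis by (rule that)
    qed
    have "norm (z j powi (k * M) - character (a j) t) < \<epsilon>" if j: "j \<in> I" for j
    proof -
      \<comment> \<open>The error of \<open>k M \<theta>\<^sub>j\<close> as an approximation of \<open>a\<^sub>j t\<close> modulo \<open>1\<close>.\<close>
      define e where "e = (\<Sum>s<r. of_int (U j s) * (of_int k * g s - of_int (m s) - t * of_int X ^ s))"
      have "of_int (k * M) * \<theta> j = of_int k * of_int (p (\<theta> j)) + (\<Sum>s<r. of_int (U j s) * (of_int k * g s))"
      proof -
        have "of_int (k * M) * \<theta> j = of_int k * (of_int M * \<theta> j)" by simp
        also have "\<dots> = of_int k * of_int (p (\<theta> j)) + (\<Sum>s<r. of_int k * (of_int (U j s) * g s))"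
          unfolding coord[OF j] distrib_left sum_distrib_left ..
        finally show ?thesis by (simp only: mult.left_commute)
      qed
      also have "(\<Sum>s<r. of_int (U j s) * (of_int k * g s))
          = e + of_int (\<Sum>s<r. U j s * m s) + of_int (a j) * t"
      proof -
        have "of_int (\<Sum>s<r. U j s * m s) = (\<Sum>s<r. of_int (U j s) * real_of_int (m s))"
          "of_int (a j) * t = (\<Sum>s<r. of_int (U j s) * (t * of_int X ^ s))"
          by (simp_all add: a_def sum_distrib_left mult_ac)
        then show ?thesis
          unfolding e_def right_diff_distrib sum_subtractf by simp
      qed
      finally have "of_int (k * M) * \<theta> j = of_int (k * p (\<theta> j) + (\<Sum>s<r. U j s * m s)) + of_int (a j) * t + e"
        by simp
      then have "z j powi (k * M) = cis (2 * pi * of_int (k * p (\<theta> j) + (\<Sum>s<r. U j s * m s))) * character (a j) t * cis (2 * pi * e)"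
        unfolding z_powi[OF j] character_def cis_mult by (simp only: distrib_left)
      then have "z j powi (k * M) - character (a j) t = character (a j) t * (cis (2 * pi * e) - 1)"
        by (simp only: cis_multiple_2pi[OF Ints_of_int] mult_1_left right_diff_distrib mult_1_right)
      then have "norm (z j powi (k * M) - character (a j) t) \<le> 2 * pi * \<bar>e\<bar>"
        using norm_cis_minus_one_le[of "2 * pi * e"] by (simp add: norm_mult abs_mult)
      also have "2 * pi * \<bar>e\<bar> \<le> 2 * pi * (W * \<delta>)"
      proof -
        have "\<bar>e\<bar> \<le> (\<Sum>s<r. \<bar>real_of_int (U j s)\<bar> * \<delta>)"
          unfolding e_def real_norm_def[symmetric]
        proof (rule sum_norm_le)
          fix s assume "s \<in> {..<r}"
          then show "norm (real_of_int (U j s) * (of_int k * g s - of_int (m s) - t * of_int X ^ s)) \<le> norm (real_of_int (U j s)) * \<delta>"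
            using km[of s] by (auto simp: abs_mult \<Theta>_def intro!: mult_left_mono)
        qed
        also have "\<dots> \<le> W * \<delta>"
          unfolding W_def sum_distrib_right[symmetric] using \<delta> I j
          by (intro mult_right_mono member_le_sum[of j I "\<lambda>j. \<Sum>s<r. \<bar>real_of_int (U j s)\<bar>"]) (auto intro: sum_nonneg)
        finally show ?thesis by simp
      qed
      also have "2 * pi * (W * \<delta>) < \<epsilon>"
      proof -
        have "2 * pi * (1 + W) \<noteq> 0" using W0 by simp
        then have "2 * pi * (1 + W) * \<delta> = \<epsilon>" unfolding \<delta>_def times_divide_eq_right by (rule nonzero_mult_div_cancel_left)
        then have "2 * pi * (W * \<delta>) + 2 * pi * \<delta> = \<epsilon>" by (simp add: algebra_simps)
        moreover have "2 * pi * \<delta> > 0" using \<delta> by simp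
        ultimately show ?thesis by linarith
      qed
      finally show ?thesis by simp
    qed
    then show ?thesis by blast
  qed
  moreover have "inj_on a I" using X unfolding a_def .
  ultimately show ?thesis by (intro that[of a])
qed

section \<open>Power sums of large length\<close>

text \<open>
  The number of blocks used for \<open>n\<close> frequencies: as \<open>ln 4 \<le> 2\<close>, the number of indices in \<open>J\<close> blocks is at
  most \<open>4 ^ J \<le> exp (2 * J) \<le> n\<close>.
\<close>

lemma four_power_sum_le:
  assumes "n > 0"
  shows "(\<Sum>i<nat \<lfloor>ln (real n) / 2\<rfloor>. 4 ^ i) \<le> n"
proof -
  define J where "J = nat \<lfloor>ln (real n) / 2\<rfloor>"
  have "(\<Sum>i<J. 4 ^ i) \<le> (4 ^ J :: nat)"
    by (induction J) auto
  also have "4 ^ J \<le> n"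
  proof -
    have "2 \<le> exp (1::real)" using exp_ge_add_one_self[of 1] by simp
    then have "(2::real) ^ (2 * J) \<le> exp 1 ^ (2 * J)" by (intro power_mono) auto
    also have "\<dots> = exp (2 * real J)" by (simp flip: exp_of_nat_mult)
    also have "\<dots> \<le> exp (ln (real n))"
    proof -
      have "ln (real n) \<ge> 0" using assms by simp
      then have "2 * real J \<le> ln (real n)" unfolding J_def by linarith
      then show ?thesis by simp
    qed
    also have "\<dots> = real n" using assms by simp
    finally have "real (4 ^ J) \<le> real n" by (simp add: power_mult)
    then show ?thesis by (simp only: of_nat_le_iff)
  qed
  finally show ?thesis unfolding J_def .
qed

text \<open>
  The approximated trigonometric sum is real, as a limit of real power sums, and a strict upper bound
  for one of its values passes to a nearby power sum.
\<close>

lemma exists_power_sum_less_log: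
  assumes inj: "inj_on z {1..n}"
    and norm: "\<And>i. i \<in> {1..n} \<Longrightarrow> norm (z i) = 1"
    and cnj: "\<And>i. i \<in> {1..n} \<Longrightarrow> z (n + 1 - i) = cnj (z i)"
    and ratio: "\<And>i j. i \<in> {1..n} \<Longrightarrow> j \<in> {1..n} \<Longrightarrow> i \<noteq> j \<Longrightarrow> \<not> is_root_of_unity (z i / z j)"
    and c: "0 \<le> c" "1 + 2 * c < real (nat \<lfloor>ln (real n) / 2\<rfloor>) / 10"
  shows "\<exists>k. Re (power_sum n z k) < - c"
proof -
  have n: "n > 0" using c by (cases n) auto
  obtain a where a: "inj_on a {1..n}"
    and approx: "\<And>t \<epsilon>. \<epsilon> > 0 \<Longrightarrow> \<exists>k::int. \<forall>j\<in>{1..n}. norm (z j powi k - character (a j) t) < \<epsilon>"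
  proof (rule powers_approximate_characters[of "{1..n}" z])
    fix a :: "nat \<Rightarrow> int"
    assume "inj_on a {1..n}"
      and "\<And>t \<epsilon>. \<epsilon> > 0 \<Longrightarrow> \<exists>k::int. \<forall>j\<in>{1..n}. norm (z j powi k - character (a j) t) < \<epsilon>"
    then show thesis by (rule that)
  qed (use norm ratio in auto)
  define A where "A = a ` {1..n}"
  have card: "card A = n" using card_image[OF a] by (simp add: A_def)
  have sum_A: "(\<Sum>x\<in>A. character x t) = (\<Sum>j=1..n. character (a j) t)" for t
    unfolding A_def sum.reindex[OF a] by simp
  have near: "\<exists>k. norm (power_sum n z k - (\<Sum>x\<in>A. character x t)) < \<epsilon>" if "\<epsilon> > 0" for t \<epsilon>
  proof -
    obtain k where k: "\<forall>j\<in>{1..n}. norm (z j powi k - character (a j) t) < \<epsilon> / n"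
      using approx[of "\<epsilon> / n" t] n \<open>\<epsilon> > 0\<close> by auto
    have "norm (\<Sum>j=1..n. z j powi k - character (a j) t) \<le> (\<Sum>j=1..n. norm (z j powi k - character (a j) t))"
      by (rule norm_sum)
    also have "\<dots> < (\<Sum>j=1..n. \<epsilon> / n)"
      using k n by (intro sum_strict_mono) auto
    also have "\<dots> = \<epsilon>" using n by simp
    finally show ?thesis
      by (intro exI[of _ k]) (simp add: power_sum_def sum_A sum_subtractf)
  qed
  have "(\<Sum>x\<in>A. character x t) \<in> \<real>" for t
  proof -
    have "\<bar>Im (\<Sum>x\<in>A. character x t)\<bar> \<le> 0 + \<epsilon>" if "\<epsilon> > 0" for \<epsilon>
    proof -
      obtain k where k: "norm (power_sum n z k - (\<Sum>x\<in>A. character x t)) < \<epsilon>"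
        using near \<open>\<epsilon> > 0\<close> by blast
      have "Im (power_sum n z k) = 0"
        using power_sum_real[of n z k] cnj by (simp add: complex_is_Real_iff)
      then show ?thesis
        using abs_Im_le_cmod[of "power_sum n z k - (\<Sum>x\<in>A. character x t)"] k
        unfolding minus_complex.sel by linarith
    qed
    then have "\<bar>Im (\<Sum>x\<in>A. character x t)\<bar> \<le> 0" by (rule field_le_epsilon)
    then show ?thesis by (simp add: complex_is_Real_iff)
  qed
  moreover have "finite A" by (simp add: A_def)
  ultimately obtain t where t: "Re (\<Sum>x\<in>A. character x t) < - c"
    using exists_character_sum_less[of A "nat \<lfloor>ln (real n) / 2\<rfloor>" c] four_power_sum_le[OF n] c
    unfolding card by blast
  then obtain k where "norm (power_sum n z k - (\<Sum>x\<in>A. character x t)) < - c - Re (\<Sum>x\<in>A. character x t)"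
    using near[of "- c - Re (\<Sum>x\<in>A. character x t)" t] by auto
  then have "Re (power_sum n z k) < - c"
    using complex_Re_le_cmod[of "power_sum n z k - (\<Sum>x\<in>A. character x t)"]
    unfolding minus_complex.sel by linarith
  then show ?thesis ..
qed

text \<open>
  Put \<open>c = ln n / pi ^ 4\<close>. If \<open>ln n < pi ^ 4\<close>, then \<open>c < 1\<close> and second moments suffice. Otherwise
  \<open>ln n \<ge> pi ^ 4 \<ge> 81\<close>, and \<open>1 + 2 * c \<le> 1 + 2 / 81 * ln n\<close> is smaller than
  \<open>(ln n / 2 - 1) / 10\<close>, a lower bound for the \<open>L\<^sup>1\<close> norm.
\<close>

theorem corollary2:
  fixes n :: nat and z :: "nat \<Rightarrow> complex"
  assumes "n > 0"
    and "inj_on z {1..n}"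
    and "\<And>i. i \<in> {1..n} \<Longrightarrow> norm (z i) = 1"
    and "\<And>i. i \<in> {1..n} \<Longrightarrow> z i \<noteq> 1"
    and "\<And>i. i \<in> {1..n} \<Longrightarrow> z (n + 1 - i) = cnj (z i)"
    and "\<And>i j. i \<in> {1..n} \<Longrightarrow> j \<in> {1..n} \<Longrightarrow> i \<noteq> j \<Longrightarrow> \<not> is_root_of_unity (z i / z j)"
  shows "(INF k::int. Re (power_sum n z k)) < - (1 / pi ^ 4) * ln (real n)"
proof -
  define c where "c = ln (real n) / pi ^ 4"
  have pi4: "81 \<le> pi ^ 4"
    using power_mono[of 3 pi 4] pi_gt3 by simp
  have "\<exists>k. Re (power_sum n z k) < - c"
  proof (cases "ln (real n) < pi ^ 4")
    case True
    then have "c < 1" using pi4 by (simp add: c_def)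
    then show ?thesis using assms(1-5) by (intro exists_power_sum_less) auto
  next
    case False
    have "c \<le> ln (real n) / 81"
      unfolding c_def using False pi4 by (intro divide_left_mono) auto
    moreover have "ln (real n) / 2 - 1 \<le> real (nat \<lfloor>ln (real n) / 2\<rfloor>)" by linarith
    ultimately have "1 + 2 * c < real (nat \<lfloor>ln (real n) / 2\<rfloor>) / 10"
      using False pi4 by argo
    moreover have "0 \<le> c" using assms(1) by (simp add: c_def)
    ultimately show ?thesis
      using assms(2,3,5,6) by (intro exists_power_sum_less_log) auto
  qed
  then obtain k where "Re (power_sum n z k) < - c" ..
  moreover have "(INF k. Re (power_sum n z k)) \<le> Re (power_sum n z k)"
    using power_sum_bdd_below[of n z] assms(3) by (intro cINF_lower) auto
  ultimately show ?thesis by (simp add: c_def)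
qed

end
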